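(* (a) Let $S_1,S_2,S_3$ be NAA. Then $[\![S_1\vee S_2]\!]=[\![S_1]\!]\cup[\![S_2]\!]$, and $S_1\vee S_2\le_m S_3$ iff $S_1\le_m S_3$ and $S_2\le_m S_3$. (b) The same two statements hold when $S_1,S_2,S_3$ are DMTS.
   Context: Fix a finite alphabet $\Sigma$. NAA: $(S,S^0,\mathrm{Tran})$ with $S^0\subseteq S$ finite, $\mathrm{Tran}:S\to 2^{\mathcal P_{\mathrm{fin}}(\Sigma\times S)}$; NAA modal refinement $R$: for $(s_1,s_2)\in R$ and $M_1\in\mathrm{Tran}_1(s_1)$ there exists $M_2\in\mathrm{Tran}_2(s_2)$ with every $(a,t_1)\in M_1$ matched by some $(a,t_2)\in M_2$ with $(t_1,t_2)\in R$ and vice versa. DMTS: $(S,S^0,\dashrightarrow,\longrightarrow)$ with $S^0$ finite, image-finite may relation $\dashrightarrow\subseteq S\times\Sigma\times S$, must relation $\longrightarrow\subseteq S\times 2^{\Sigma\times S}$ with $s\longrightarrow N$, $(a,t)\in N$ implying $s\overset a\dashrightarrow t$; DMTS modal refinement $R$: for $(s_1,s_2)\in R$, every $s_1\overset a\dashrightarrow t_1$ is matched by $s_2\overset a\dashrightarrow t_2$ with $(t_1,t_2)\in R$ and every $s_2\longrightarrow N_2$ by some $s_1\longrightarrow N_1$ with each $(a,t_1)\in N_1$ having $(a,t_2)\in N_2$, $(t_1,t_2)\in R$. A refinement is initialised if each initial state on the left is related to some initial state on the right; $S_1\le_m S_2$ iff one exists. An LTS $(I,i^0,\to)$ (image-finite)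 is the NAA with initial set $\{i^0\}$ and $\mathrm{Tran}(s)=\{\{(a,t)\mid s\xrightarrow at\}\}$, resp. the DMTS with may $=\to$ and must $=\{(s,\{(a,t)\})\mid s\xrightarrow a t\}$; $[\![S]\!]$ is the set of LTS $I$ with $I\le_m S$. Disjunction (state sets assumed disjoint): for NAA, $S_1\vee S_2=(S_1\cup S_2,S_1^0\cup S_2^0,\mathrm{Tran}_1\cup\mathrm{Tran}_2)$; for DMTS, $S_1\vee S_2=(S_1\cup S_2,S_1^0\cup S_2^0,\dashrightarrow_1\cup\dashrightarrow_2,\longrightarrow_1\cup\longrightarrow_2)$. *)

theory Defs
  imports Main
begin

text \<open>
  Structures carry an explicit state set inside a type of potential states, and the alphabet
  is an explicit set \<open>\<Sigma>\<close>. Only the restriction of \<open>naa_tran\<close> to the state set is meaningful.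
\<close>

record ('s, 'a) naa =
  naa_states :: "'s set"
  naa_init :: "'s set"
  naa_tran :: "'s \<Rightarrow> ('a \<times> 's) set set"

definition is_naa :: "'a set \<Rightarrow> ('s, 'a) naa \<Rightarrow> bool" where
  "is_naa \<Sigma> S \<longleftrightarrow>
     naa_init S \<subseteq> naa_states S \<and> finite (naa_init S) \<and>
     (\<forall>s \<in> naa_states S. \<forall>M \<in> naa_tran S s. finite M \<and> M \<subseteq> \<Sigma> \<times> naa_states S)"

definition naa_refinement :: "('s, 'a) naa \<Rightarrow> ('t, 'a) naa \<Rightarrow> ('s \<times> 't) set \<Rightarrow> bool" where
  "naa_refinement S\<^sub>1 S\<^sub>2 R \<longleftrightarrow>
     R \<subseteq> naa_states S\<^sub>1 \<times> naa_states S\<^sub>2 \<and>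
     (\<forall>(s\<^sub>1, s\<^sub>2) \<in> R. \<forall>M\<^sub>1 \<in> naa_tran S\<^sub>1 s\<^sub>1. \<exists>M\<^sub>2 \<in> naa_tran S\<^sub>2 s\<^sub>2.
        (\<forall>(a, t\<^sub>1) \<in> M\<^sub>1. \<exists>t\<^sub>2. (a, t\<^sub>2) \<in> M\<^sub>2 \<and> (t\<^sub>1, t\<^sub>2) \<in> R) \<and>
        (\<forall>(a, t\<^sub>2) \<in> M\<^sub>2. \<exists>t\<^sub>1. (a, t\<^sub>1) \<in> M\<^sub>1 \<and> (t\<^sub>1, t\<^sub>2) \<in> R))"

definition initialised :: "'s set \<Rightarrow> 't set \<Rightarrow> ('s \<times> 't) set \<Rightarrow> bool" where
  "initialised I\<^sub>1 I\<^sub>2 R \<longleftrightarrow> (\<forall>s\<^sub>1 \<in> I\<^sub>1. \<exists>s\<^sub>2 \<in> I\<^sub>2. (s\<^sub>1, s\<^sub>2) \<in> R)"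

definition naa_refines :: "('s, 'a) naa \<Rightarrow> ('t, 'a) naa \<Rightarrow> bool" (infix \<open>\<le>\<^sub>N\<close> 50) where
  "S\<^sub>1 \<le>\<^sub>N S\<^sub>2 \<longleftrightarrow>
     (\<exists>R. naa_refinement S\<^sub>1 S\<^sub>2 R \<and> initialised (naa_init S\<^sub>1) (naa_init S\<^sub>2) R)"

record ('s, 'a) dmts =
  dmts_states :: "'s set"
  dmts_init :: "'s set"
  dmts_may :: "('s \<times> 'a \<times> 's) set"
  dmts_must :: "('s \<times> ('a \<times> 's) set) set"

definition is_dmts :: "'a set \<Rightarrow> ('s, 'a) dmts \<Rightarrow> bool" where
  "is_dmts \<Sigma> S \<longleftrightarrow>
     dmts_init S \<subseteq> dmts_states S \<and> finite (dmts_init S) \<and>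
     dmts_may S \<subseteq> dmts_states S \<times> \<Sigma> \<times> dmts_states S \<and>
     (\<forall>s \<in> dmts_states S. \<forall>a \<in> \<Sigma>. finite {t. (s, a, t) \<in> dmts_may S}) \<and>
     dmts_must S \<subseteq> dmts_states S \<times> Pow (\<Sigma> \<times> dmts_states S) \<and>
     (\<forall>(s, N) \<in> dmts_must S. \<forall>(a, t) \<in> N. (s, a, t) \<in> dmts_may S)"

definition dmts_refinement :: "('s, 'a) dmts \<Rightarrow> ('t, 'a) dmts \<Rightarrow> ('s \<times> 't) set \<Rightarrow> bool" where
  "dmts_refinement S\<^sub>1 S\<^sub>2 R \<longleftrightarrow>
     R \<subseteq> dmts_states S\<^sub>1 \<times> dmts_states S\<^sub>2 \<and>
     (\<forall>(s\<^sub>1, s\<^sub>2) \<in> R.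
        (\<forall>a t\<^sub>1. (s\<^sub>1, a, t\<^sub>1) \<in> dmts_may S\<^sub>1 \<longrightarrow>
           (\<exists>t\<^sub>2. (s\<^sub>2, a, t\<^sub>2) \<in> dmts_may S\<^sub>2 \<and> (t\<^sub>1, t\<^sub>2) \<in> R)) \<and>
        (\<forall>N\<^sub>2. (s\<^sub>2, N\<^sub>2) \<in> dmts_must S\<^sub>2 \<longrightarrow>
           (\<exists>N\<^sub>1. (s\<^sub>1, N\<^sub>1) \<in> dmts_must S\<^sub>1 \<and>
              (\<forall>(a, t\<^sub>1) \<in> N\<^sub>1. \<exists>t\<^sub>2. (a, t\<^sub>2) \<in> N\<^sub>2 \<and> (t\<^sub>1, t\<^sub>2) \<in> R))))"

definition dmts_refines :: "('s, 'a) dmts \<Rightarrow> ('t, 'a) dmts \<Rightarrow> bool" (infix \<open>\<le>\<^sub>D\<close> 50) where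
  "S\<^sub>1 \<le>\<^sub>D S\<^sub>2 \<longleftrightarrow>
     (\<exists>R. dmts_refinement S\<^sub>1 S\<^sub>2 R \<and> initialised (dmts_init S\<^sub>1) (dmts_init S\<^sub>2) R)"

record ('s, 'a) lts =
  lts_states :: "'s set"
  lts_init :: "'s"
  lts_trans :: "('s \<times> 'a \<times> 's) set"

definition is_lts :: "'a set \<Rightarrow> ('s, 'a) lts \<Rightarrow> bool" where
  "is_lts \<Sigma> I \<longleftrightarrow>
     lts_init I \<in> lts_states I \<and>
     lts_trans I \<subseteq> lts_states I \<times> \<Sigma> \<times> lts_states I \<and>
     (\<forall>s \<in> lts_states I. \<forall>a \<in> \<Sigma>. finite {t. (s, a, t) \<in> lts_trans I})"

definition naa_of_lts :: "('s, 'a) lts \<Rightarrow> ('s, 'a) naa" where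
  "naa_of_lts I =
     \<lparr>naa_states = lts_states I, naa_init = {lts_init I},
      naa_tran = (\<lambda>s. {{(a, t). (s, a, t) \<in> lts_trans I}})\<rparr>"

definition dmts_of_lts :: "('s, 'a) lts \<Rightarrow> ('s, 'a) dmts" where
  "dmts_of_lts I =
     \<lparr>dmts_states = lts_states I, dmts_init = {lts_init I},
      dmts_may = lts_trans I,
      dmts_must = {(s, {(a, t)}) | s a t. (s, a, t) \<in> lts_trans I}\<rparr>"

text \<open>
  The state type \<open>'i\<close> of the implementations is independent of the state type of the
  specification.
\<close>

definition naa_impl :: "'a set \<Rightarrow> ('s, 'a) naa \<Rightarrow> ('i, 'a) lts set" where
  "naa_impl \<Sigma> S = {I. is_lts \<Sigma> I \<and> naa_of_lts I \<le>\<^sub>N S}"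

definition dmts_impl :: "'a set \<Rightarrow> ('s, 'a) dmts \<Rightarrow> ('i, 'a) lts set" where
  "dmts_impl \<Sigma> S = {I. is_lts \<Sigma> I \<and> dmts_of_lts I \<le>\<^sub>D S}"

text \<open>
  Both disjunctions are meant for structures with disjoint state sets. The conditional below is
  then the union of the two transition functions, each restricted to its own state set.
\<close>

definition naa_disj :: "('s, 'a) naa \<Rightarrow> ('s, 'a) naa \<Rightarrow> ('s, 'a) naa" (infixr \<open>\<or>\<^sub>N\<close> 65) where
  "S\<^sub>1 \<or>\<^sub>N S\<^sub>2 =
     \<lparr>naa_states = naa_states S\<^sub>1 \<union> naa_states S\<^sub>2,
      naa_init = naa_init S\<^sub>1 \<union> naa_init S\<^sub>2,
      naa_tran = (\<lambda>s. if s \<in> naa_states S\<^sub>1 then naa_tran S\<^sub>1 s else naa_tran S\<^sub>2 s)\<rparr>"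

definition dmts_disj :: "('s, 'a) dmts \<Rightarrow> ('s, 'a) dmts \<Rightarrow> ('s, 'a) dmts" (infixr \<open>\<or>\<^sub>D\<close> 65) where
  "S\<^sub>1 \<or>\<^sub>D S\<^sub>2 =
     \<lparr>dmts_states = dmts_states S\<^sub>1 \<union> dmts_states S\<^sub>2,
      dmts_init = dmts_init S\<^sub>1 \<union> dmts_init S\<^sub>2,
      dmts_may = dmts_may S\<^sub>1 \<union> dmts_may S\<^sub>2,
      dmts_must = dmts_must S\<^sub>1 \<union> dmts_must S\<^sub>2\<rparr>"

lemma is_naa_naa_of_lts:
  assumes "finite \<Sigma>" and "is_lts \<Sigma> I"
  shows "is_naa \<Sigma> (naa_of_lts I)"
proof -
  have "finite {(a, t). (s, a, t) \<in> lts_trans I}" if "s \<in> lts_states I" for s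
  proof -
    have "{(a, t). (s, a, t) \<in> lts_trans I} =
        (SIGMA a:\<Sigma>. {t. (s, a, t) \<in> lts_trans I})"
      using assms(2) by (auto simp: is_lts_def)
    then show ?thesis
      using assms that by (auto simp: is_lts_def)
  qed
  then show ?thesis
    using assms(2) by (auto simp: is_lts_def is_naa_def naa_of_lts_def)
qed

lemma is_dmts_dmts_of_lts: "is_lts \<Sigma> I \<Longrightarrow> is_dmts \<Sigma> (dmts_of_lts I)"
  by (auto simp: is_lts_def is_dmts_def dmts_of_lts_def)

lemma is_naa_naa_disj:
  assumes "is_naa \<Sigma> S\<^sub>1" and "is_naa \<Sigma> S\<^sub>2"
  shows "is_naa \<Sigma> (S\<^sub>1 \<or>\<^sub>N S\<^sub>2)"
  unfolding is_naa_def
proof (intro conjI ballI)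
  fix s M
  assume "s \<in> naa_states (S\<^sub>1 \<or>\<^sub>N S\<^sub>2)" and "M \<in> naa_tran (S\<^sub>1 \<or>\<^sub>N S\<^sub>2) s"
  then have "s \<in> naa_states S\<^sub>1 \<and> M \<in> naa_tran S\<^sub>1 s \<or> s \<in> naa_states S\<^sub>2 \<and> M \<in> naa_tran S\<^sub>2 s"
    by (auto simp: naa_disj_def split: if_splits)
  then have "finite M \<and> (M \<subseteq> \<Sigma> \<times> naa_states S\<^sub>1 \<or> M \<subseteq> \<Sigma> \<times> naa_states S\<^sub>2)"
    using assms unfolding is_naa_def by metis
  then show "finite M" and "M \<subseteq> \<Sigma> \<times> naa_states (S\<^sub>1 \<or>\<^sub>N S\<^sub>2)"
    by (auto simp: naa_disj_def)
qed (use assms in \<open>auto simp: is_naa_def naa_disj_def\<close>)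

lemma is_dmts_dmts_disj:
  fixes S\<^sub>1 S\<^sub>2 :: "('s, 'a) dmts"
  assumes "is_dmts \<Sigma> S\<^sub>1" and "is_dmts \<Sigma> S\<^sub>2"
  shows "is_dmts \<Sigma> (S\<^sub>1 \<or>\<^sub>D S\<^sub>2)"
proof -
  have fin: "finite {t. (s, a, t) \<in> dmts_may S}" if "is_dmts \<Sigma> S" for s a and S :: "('s, 'a) dmts"
  proof (cases "s \<in> dmts_states S \<and> a \<in> \<Sigma>")
    case False
    then have "{t. (s, a, t) \<in> dmts_may S} = {}"
      using that by (auto simp: is_dmts_def)
    then show ?thesis by simp
  qed (use that in \<open>simp add: is_dmts_def\<close>)
  note d1 = assms(1)[unfolded is_dmts_def] and d2 = assms(2)[unfolded is_dmts_def]
  show ?thesis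
    unfolding is_dmts_def
  proof (intro conjI ballI)
    show "dmts_may (S\<^sub>1 \<or>\<^sub>D S\<^sub>2) \<subseteq> dmts_states (S\<^sub>1 \<or>\<^sub>D S\<^sub>2) \<times> \<Sigma> \<times> dmts_states (S\<^sub>1 \<or>\<^sub>D S\<^sub>2)"
      using d1[THEN conjunct2, THEN conjunct2, THEN conjunct1]
        d2[THEN conjunct2, THEN conjunct2, THEN conjunct1]
      by (auto simp: dmts_disj_def)
    show "finite {t. (s, a, t) \<in> dmts_may (S\<^sub>1 \<or>\<^sub>D S\<^sub>2)}" for s a
      using fin[OF assms(1)] fin[OF assms(2)] by (simp add: dmts_disj_def Collect_disj_eq)
    have "dmts_must S\<^sub>1 \<subseteq> dmts_states S\<^sub>1 \<times> Pow (\<Sigma> \<times> dmts_states S\<^sub>1)"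
      "dmts_must S\<^sub>2 \<subseteq> dmts_states S\<^sub>2 \<times> Pow (\<Sigma> \<times> dmts_states S\<^sub>2)"
      using d1 d2 by simp_all
    then show "dmts_must (S\<^sub>1 \<or>\<^sub>D S\<^sub>2) \<subseteq>
        dmts_states (S\<^sub>1 \<or>\<^sub>D S\<^sub>2) \<times> Pow (\<Sigma> \<times> dmts_states (S\<^sub>1 \<or>\<^sub>D S\<^sub>2))"
      by (fastforce simp: dmts_disj_def)
    show "case p of (s, N) \<Rightarrow> \<forall>(a, t) \<in> N. (s, a, t) \<in> dmts_may (S\<^sub>1 \<or>\<^sub>D S\<^sub>2)"
      if "p \<in> dmts_must (S\<^sub>1 \<or>\<^sub>D S\<^sub>2)" for p
    proof -
      have "\<forall>(s, N) \<in> dmts_must S\<^sub>1. \<forall>(a, t) \<in> N. (s, a, t) \<in> dmts_may S\<^sub>1"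
        "\<forall>(s, N) \<in> dmts_must S\<^sub>2. \<forall>(a, t) \<in> N. (s, a, t) \<in> dmts_may S\<^sub>2"
        using d1 d2 by simp_all
      then show ?thesis
        using that by (fastforce simp: dmts_disj_def)
    qed
  qed (use d1 d2 in \<open>simp_all add: dmts_disj_def le_supI1 le_supI2\<close>)
qed

end

theory Submission
  imports Defs
begin

text \<open>
  Each disjunct is a part of the disjunction that no transition leaves and whose states have
  exactly the transitions they have in the disjunction. A refinement into or out of the
  disjunction therefore restricts to a refinement into or out of a disjunct, and conversely a
  refinement for a disjunct is one for the disjunction. Unions of refinements give the least upper
  bound property. For the implementations it is decisive that an LTS has a single initial state,
  which is related to an initial state of one of the disjuncts.
\<close>

section \<open>NAA: components and the matching of transition sets\<close>

text \<open>Initial states are left out on purpose: \<open>naa_refinement\<close> does not mention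
  them, and initialisation is checked separately for each disjunction statement.\<close>

definition naa_component :: "('s, 'a) naa \<Rightarrow> ('s, 'a) naa \<Rightarrow> bool" where
  "naa_component T S \<longleftrightarrow>
     naa_states T \<subseteq> naa_states S \<and>
     (\<forall>s \<in> naa_states T. naa_tran T s = naa_tran S s \<and>
        (\<forall>M \<in> naa_tran T s. \<forall>a t. (a, t) \<in> M \<longrightarrow> t \<in> naa_states T))"

text \<open>This is the Egli-Milner lifting of \<open>R\<close> to sets of labelled states, with
  labels required to agree. Isolating it lets the effect of enlarging or shrinking \<open>R\<close>
  be studied apart from the transition functions.\<close>

definition label_matching :: "('s \<times> 't) set \<Rightarrow> ('a \<times> 's) set \<Rightarrow> ('a \<times> 't) set \<Rightarrow> bool" where
  "label_matching R M N \<longleftrightarrow>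
     (\<forall>a s. (a, s) \<in> M \<longrightarrow> (\<exists>t. (a, t) \<in> N \<and> (s, t) \<in> R)) \<and>
     (\<forall>a t. (a, t) \<in> N \<longrightarrow> (\<exists>s. (a, s) \<in> M \<and> (s, t) \<in> R))"

lemma label_matching_mono: "label_matching R M N \<Longrightarrow> R \<subseteq> R' \<Longrightarrow> label_matching R' M N"
  unfolding label_matching_def by (metis subsetD)

text \<open>In both directions of the matching, the left end of every pair used is a target in
  \<open>M\<close>, so it lies in \<open>X\<close> and the pair survives the restriction.\<close>

lemma label_matching_restrict_left:
  assumes "label_matching R M N" and "\<And>a s. (a, s) \<in> M \<Longrightarrow> s \<in> X"
  shows "label_matching (R \<inter> X \<times> UNIV) M N"
  using assms unfolding label_matching_def by (meson IntI SigmaI UNIV_I)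

lemma label_matching_restrict_right:
  assumes "label_matching R M N" and "\<And>a t. (a, t) \<in> N \<Longrightarrow> t \<in> Y"
  shows "label_matching (R \<inter> UNIV \<times> Y) M N"
  using assms unfolding label_matching_def by (meson IntI SigmaI UNIV_I)

lemma naa_refinement_iff:
  "naa_refinement S T R \<longleftrightarrow>
     R \<subseteq> naa_states S \<times> naa_states T \<and>
     (\<forall>(s, t) \<in> R. \<forall>M \<in> naa_tran S s. \<exists>N \<in> naa_tran T t. label_matching R M N)"
  by (simp add: naa_refinement_def label_matching_def Ball_def)

lemma naa_refinementD:
  assumes "naa_refinement S T R" and "(s, t) \<in> R"
  shows "s \<in> naa_states S" and "t \<in> naa_states T"
    and "M \<in> naa_tran S s \<Longrightarrow> \<exists>N \<in> naa_tran T t. label_matching R M N"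
  using assms unfolding naa_refinement_iff by blast+

lemma naa_refinementI:
  assumes "\<And>s t. (s, t) \<in> R \<Longrightarrow> s \<in> naa_states S \<and> t \<in> naa_states T"
    and "\<And>s t M. (s, t) \<in> R \<Longrightarrow> M \<in> naa_tran S s \<Longrightarrow>
      \<exists>N \<in> naa_tran T t. label_matching R M N"
  shows "naa_refinement S T R"
  using assms by (auto simp: naa_refinement_iff)

lemma naa_componentD:
  assumes "naa_component T S" and "s \<in> naa_states T"
  shows "s \<in> naa_states S" and "naa_tran S s = naa_tran T s"
    and "M \<in> naa_tran T s \<Longrightarrow> (a, t) \<in> M \<Longrightarrow> t \<in> naa_states T"
  using assms unfolding naa_component_def by blast+

text \<open>Closure under transitions comes from \<open>is_naa\<close>. Disjointness ensures that on
  states of \<open>S\<^sub>2\<close> the conditional in \<open>naa_disj\<close> selects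
  \<open>naa_tran S\<^sub>2\<close>.\<close>

lemma naa_component_disj:
  fixes S\<^sub>1 S\<^sub>2 :: "('s, 'a) naa"
  assumes "is_naa \<Sigma> S\<^sub>1" and "is_naa \<Sigma> S\<^sub>2" and "naa_states S\<^sub>1 \<inter> naa_states S\<^sub>2 = {}"
  shows "naa_component S\<^sub>1 (S\<^sub>1 \<or>\<^sub>N S\<^sub>2)" and "naa_component S\<^sub>2 (S\<^sub>1 \<or>\<^sub>N S\<^sub>2)"
proof -
  have "t \<in> naa_states S"
    if "is_naa \<Sigma> S" "s \<in> naa_states S" "M \<in> naa_tran S s" "(a, t) \<in> M"
    for S :: "('s, 'a) naa" and s M a t
  proof -
    have "M \<subseteq> \<Sigma> \<times> naa_states S"
      using that(1-3) by (simp add: is_naa_def)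
    then show ?thesis
      using that(4) by blast
  qed
  then show "naa_component S\<^sub>1 (S\<^sub>1 \<or>\<^sub>N S\<^sub>2)" "naa_component S\<^sub>2 (S\<^sub>1 \<or>\<^sub>N S\<^sub>2)"
    using assms by (auto simp: naa_component_def naa_disj_def)
qed

section \<open>Union, extension and restriction of NAA refinements\<close>

lemma naa_refinement_Un:
  assumes "naa_refinement S T R" and "naa_refinement S T R'"
  shows "naa_refinement S T (R \<union> R')"
  using assms unfolding naa_refinement_iff
  by (blast intro: label_matching_mono)

text \<open>The same \<open>R\<close> works: it relates only states of \<open>T\<close>, and there
  \<open>S\<close> offers the same transition sets.\<close>

lemma naa_refinement_extend_left:
  assumes "naa_component T S" and "naa_refinement T U R"
  shows "naa_refinement S U R"
proof (rule naa_refinementI)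
  fix s u
  assume "(s, u) \<in> R"
  note D = naa_refinementD[OF assms(2) this] and C = naa_componentD[OF assms(1) D(1)]
  show "s \<in> naa_states S \<and> u \<in> naa_states U"
    using C D by blast
  show "\<exists>N \<in> naa_tran U u. label_matching R M N"
    if M: "M \<in> naa_tran S s" for M
    using M D(3) unfolding C(2) by blast
qed

lemma naa_refinement_extend_right:
  assumes "naa_component T S" and "naa_refinement U T R"
  shows "naa_refinement U S R"
proof (rule naa_refinementI)
  fix u s
  assume "(u, s) \<in> R"
  note D = naa_refinementD[OF assms(2) this] and C = naa_componentD[OF assms(1) D(2)]
  show "u \<in> naa_states U \<and> s \<in> naa_states S"
    using C D by blast
  show "\<exists>N \<in> naa_tran S s. label_matching R M N"
    if M: "M \<in> naa_tran U u" for M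
    using M D(3) unfolding C(2) by blast
qed

text \<open>Targets of a transition set of \<open>T\<close> stay in \<open>T\<close>, so a matching
  obtained from \<open>R\<close> never uses a pair that the restriction discards.\<close>

lemma naa_refinement_restrict_left:
  assumes "naa_component T S" and "naa_refinement S U R"
  shows "naa_refinement T U (R \<inter> naa_states T \<times> UNIV)"
    (is "naa_refinement _ _ ?R")
proof (rule naa_refinementI)
  fix s u
  assume "(s, u) \<in> ?R"
  then have rel: "(s, u) \<in> R" and mem: "s \<in> naa_states T"
    by auto
  note D = naa_refinementD[OF assms(2) rel] and C = naa_componentD[OF assms(1) mem]
  show "s \<in> naa_states T \<and> u \<in> naa_states U"
    using C D mem by blast
  show "\<exists>N \<in> naa_tran U u. label_matching ?R M N"
    if M: "M \<in> naa_tran T s" for M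
  proof -
    obtain N where N: "N \<in> naa_tran U u" "label_matching R M N"
      using M D(3)[of M] C(2) by auto
    then have "label_matching ?R M N"
      using C(2,3) M by (blast intro: label_matching_restrict_left)
    then show ?thesis
      using N C(2) by blast
  qed
qed

lemma naa_refinement_restrict_right:
  assumes "naa_component T S" and "naa_refinement U S R"
  shows "naa_refinement U T (R \<inter> UNIV \<times> naa_states T)"
    (is "naa_refinement _ _ ?R")
proof (rule naa_refinementI)
  fix u s
  assume "(u, s) \<in> ?R"
  then have rel: "(u, s) \<in> R" and mem: "s \<in> naa_states T"
    by auto
  note D = naa_refinementD[OF assms(2) rel] and C = naa_componentD[OF assms(1) mem]
  show "u \<in> naa_states U \<and> s \<in> naa_states T"
    using C D mem by blast
  show "\<exists>N \<in> naa_tran T s. label_matching ?R M N"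
    if M: "M \<in> naa_tran U u" for M
  proof -
    obtain N where N: "N \<in> naa_tran S s" "label_matching R M N"
      using M D(3)[of M] C(2) by auto
    \<comment> \<open>Here it is the answering set \<open>N\<close> that is confined: by
      \<open>C(2)\<close> it is a transition set of \<open>T\<close> at \<open>s\<close>, so its
      targets lie in \<open>T\<close>.\<close>
    then have "label_matching ?R M N"
      using C(2,3) M by (blast intro: label_matching_restrict_right)
    then show ?thesis
      using N C(2) by blast
  qed
qed

section \<open>Disjunction of NAA as least upper bound and as union of implementations\<close>

lemma naa_disj_refines_iff:
  assumes "is_naa \<Sigma> S\<^sub>1" and "is_naa \<Sigma> S\<^sub>2" and "naa_states S\<^sub>1 \<inter> naa_states S\<^sub>2 = {}"
  shows "S\<^sub>1 \<or>\<^sub>N S\<^sub>2 \<le>\<^sub>N S\<^sub>3 \<longleftrightarrow> S\<^sub>1 \<le>\<^sub>N S\<^sub>3 \<and> S\<^sub>2 \<le>\<^sub>N S\<^sub>3"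
proof
  note comp = naa_component_disj[OF assms]
  have init: "naa_init S\<^sub>1 \<subseteq> naa_states S\<^sub>1" "naa_init S\<^sub>2 \<subseteq> naa_states S\<^sub>2"
    using assms(1,2) by (simp_all add: is_naa_def)
  show "S\<^sub>1 \<le>\<^sub>N S\<^sub>3 \<and> S\<^sub>2 \<le>\<^sub>N S\<^sub>3" if le: "S\<^sub>1 \<or>\<^sub>N S\<^sub>2 \<le>\<^sub>N S\<^sub>3"
  proof -
    obtain R where ref: "naa_refinement (S\<^sub>1 \<or>\<^sub>N S\<^sub>2) S\<^sub>3 R"
      and ini: "initialised (naa_init (S\<^sub>1 \<or>\<^sub>N S\<^sub>2)) (naa_init S\<^sub>3) R"
      using le unfolding naa_refines_def by blast
    \<comment> \<open>Initial states of a disjunct belong to its state set, so the pairs witnessing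
      initialisation survive the restriction.\<close>
    have "initialised (naa_init S\<^sub>1) (naa_init S\<^sub>3) (R \<inter> naa_states S\<^sub>1 \<times> UNIV)"
      "initialised (naa_init S\<^sub>2) (naa_init S\<^sub>3) (R \<inter> naa_states S\<^sub>2 \<times> UNIV)"
      using ini init by (auto simp: initialised_def naa_disj_def)
    then show ?thesis
      using comp[THEN naa_refinement_restrict_left, OF ref] unfolding naa_refines_def by blast
  qed
  show "S\<^sub>1 \<or>\<^sub>N S\<^sub>2 \<le>\<^sub>N S\<^sub>3" if le: "S\<^sub>1 \<le>\<^sub>N S\<^sub>3 \<and> S\<^sub>2 \<le>\<^sub>N S\<^sub>3"
  proof -
    obtain R\<^sub>1 R\<^sub>2 where ref: "naa_refinement S\<^sub>1 S\<^sub>3 R\<^sub>1" "naa_refinement S\<^sub>2 S\<^sub>3 R\<^sub>2"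
      and ini: "initialised (naa_init S\<^sub>1) (naa_init S\<^sub>3) R\<^sub>1"
        "initialised (naa_init S\<^sub>2) (naa_init S\<^sub>3) R\<^sub>2"
      using le unfolding naa_refines_def by blast
    have "naa_refinement (S\<^sub>1 \<or>\<^sub>N S\<^sub>2) S\<^sub>3 (R\<^sub>1 \<union> R\<^sub>2)"
      \<comment> \<open>Both relations are first extended to the whole disjunction, because the
        union lemma needs a common source structure.\<close>
      using comp ref by (intro naa_refinement_Un) (blast intro: naa_refinement_extend_left)+
    moreover have "initialised (naa_init (S\<^sub>1 \<or>\<^sub>N S\<^sub>2)) (naa_init S\<^sub>3) (R\<^sub>1 \<union> R\<^sub>2)"
      using ini by (fastforce simp: initialised_def naa_disj_def)
    ultimately show ?thesis
      unfolding naa_refines_def by blast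
  qed
qed

text \<open>The singleton initial set carries the forward direction: with several initial states,
  some could be matched in \<open>S\<^sub>1\<close> and others only in
  \<open>S\<^sub>2\<close>.\<close>

lemma refines_naa_disj_iff:
  assumes "is_naa \<Sigma> S\<^sub>1" and "is_naa \<Sigma> S\<^sub>2" and "naa_states S\<^sub>1 \<inter> naa_states S\<^sub>2 = {}"
    and "naa_init I = {i}"
  shows "I \<le>\<^sub>N S\<^sub>1 \<or>\<^sub>N S\<^sub>2 \<longleftrightarrow> I \<le>\<^sub>N S\<^sub>1 \<or> I \<le>\<^sub>N S\<^sub>2"
proof
  note comp = naa_component_disj[OF assms(1-3)]
  have init: "naa_init S\<^sub>1 \<subseteq> naa_states S\<^sub>1" "naa_init S\<^sub>2 \<subseteq> naa_states S\<^sub>2"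
    using assms(1,2) by (simp_all add: is_naa_def)
  show "I \<le>\<^sub>N S\<^sub>1 \<or> I \<le>\<^sub>N S\<^sub>2" if le: "I \<le>\<^sub>N S\<^sub>1 \<or>\<^sub>N S\<^sub>2"
  proof -
    obtain R where ref: "naa_refinement I (S\<^sub>1 \<or>\<^sub>N S\<^sub>2) R"
      and ini: "initialised (naa_init I) (naa_init (S\<^sub>1 \<or>\<^sub>N S\<^sub>2)) R"
      using le unfolding naa_refines_def by blast
    \<comment> \<open>The partner of \<open>i\<close> under \<open>R\<close> is initial in one of
      the disjuncts, hence a state of it; this decides which restriction is initialised.\<close>
    have "initialised (naa_init I) (naa_init S\<^sub>1) (R \<inter> UNIV \<times> naa_states S\<^sub>1) \<or>
      initialised (naa_init I) (naa_init S\<^sub>2) (R \<inter> UNIV \<times> naa_states S\<^sub>2)"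
      using ini init assms(4) by (auto simp: initialised_def naa_disj_def)
    then show ?thesis
      using comp[THEN naa_refinement_restrict_right, OF ref] unfolding naa_refines_def by blast
  qed
  show "I \<le>\<^sub>N S\<^sub>1 \<or>\<^sub>N S\<^sub>2" if le: "I \<le>\<^sub>N S\<^sub>1 \<or> I \<le>\<^sub>N S\<^sub>2"
  proof -
    obtain R where "naa_refinement I (S\<^sub>1 \<or>\<^sub>N S\<^sub>2) R"
      and "initialised (naa_init I) (naa_init S\<^sub>1) R \<or> initialised (naa_init I) (naa_init S\<^sub>2) R"
      using le comp[THEN naa_refinement_extend_right] unfolding naa_refines_def by blast
    moreover from this(2) have "initialised (naa_init I) (naa_init (S\<^sub>1 \<or>\<^sub>N S\<^sub>2)) R"
      by (auto simp: initialised_def naa_disj_def)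
    ultimately show ?thesis
      unfolding naa_refines_def by blast
  qed
qed

lemma naa_impl_disj:
  assumes "is_naa \<Sigma> S\<^sub>1" and "is_naa \<Sigma> S\<^sub>2" and "naa_states S\<^sub>1 \<inter> naa_states S\<^sub>2 = {}"
  shows "naa_impl \<Sigma> (S\<^sub>1 \<or>\<^sub>N S\<^sub>2) = naa_impl \<Sigma> S\<^sub>1 \<union> naa_impl \<Sigma> S\<^sub>2"
proof -
  have "naa_init (naa_of_lts I) = {lts_init I}" for I :: "('i, 'a) lts"
    by (simp add: naa_of_lts_def)
  from refines_naa_disj_iff[OF assms this] show ?thesis
    by (auto simp: naa_impl_def)
qed

section \<open>DMTS: components of a disjunction\<close>

text \<open>Since \<open>is_dmts\<close> is not presupposed here, closure under must transitions is
  demanded separately and not derived from closure under may transitions.\<close>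

definition dmts_component :: "('s, 'a) dmts \<Rightarrow> ('s, 'a) dmts \<Rightarrow> bool" where
  "dmts_component T S \<longleftrightarrow>
     dmts_states T \<subseteq> dmts_states S \<and>
     (\<forall>s \<in> dmts_states T.
        (\<forall>a t. (s, a, t) \<in> dmts_may T \<longleftrightarrow> (s, a, t) \<in> dmts_may S) \<and>
        (\<forall>a t. (s, a, t) \<in> dmts_may T \<longrightarrow> t \<in> dmts_states T) \<and>
        (\<forall>N. (s, N) \<in> dmts_must T \<longleftrightarrow> (s, N) \<in> dmts_must S) \<and>
        (\<forall>N a t. (s, N) \<in> dmts_must T \<longrightarrow> (a, t) \<in> N \<longrightarrow> t \<in> dmts_states T))"

lemma dmts_refinementD:
  assumes "dmts_refinement S T R" and "(s, t) \<in> R"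
  shows "s \<in> dmts_states S" and "t \<in> dmts_states T"
    and "(s, a, s') \<in> dmts_may S \<Longrightarrow> \<exists>t'. (t, a, t') \<in> dmts_may T \<and> (s', t') \<in> R"
    and "(t, N) \<in> dmts_must T \<Longrightarrow> \<exists>M. (s, M) \<in> dmts_must S \<and>
      (\<forall>a s'. (a, s') \<in> M \<longrightarrow> (\<exists>t'. (a, t') \<in> N \<and> (s', t') \<in> R))"
  using assms unfolding dmts_refinement_def Ball_def split_paired_All prod.case by blast+

lemma dmts_refinementI:
  assumes "\<And>s t. (s, t) \<in> R \<Longrightarrow> s \<in> dmts_states S \<and> t \<in> dmts_states T"
    and "\<And>s t a s'. (s, t) \<in> R \<Longrightarrow> (s, a, s') \<in> dmts_may S \<Longrightarrow>
      \<exists>t'. (t, a, t') \<in> dmts_may T \<and> (s', t') \<in> R"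
    and "\<And>s t N. (s, t) \<in> R \<Longrightarrow> (t, N) \<in> dmts_must T \<Longrightarrow> \<exists>M. (s, M) \<in> dmts_must S \<and>
      (\<forall>a s'. (a, s') \<in> M \<longrightarrow> (\<exists>t'. (a, t') \<in> N \<and> (s', t') \<in> R))"
  shows "dmts_refinement S T R"
  unfolding dmts_refinement_def Ball_def split_paired_All prod.case
  by (intro conjI allI impI) (use assms(1) in auto, (rule assms(2,3); assumption)+)

lemma dmts_componentD:
  assumes "dmts_component T S" and "s \<in> dmts_states T"
  shows "s \<in> dmts_states S"
    and "(s, a, t) \<in> dmts_may S \<longleftrightarrow> (s, a, t) \<in> dmts_may T"
    and "(s, a, t) \<in> dmts_may T \<Longrightarrow> t \<in> dmts_states T"
    and "(s, N) \<in> dmts_must S \<longleftrightarrow> (s, N) \<in> dmts_must T"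
    and "(s, N) \<in> dmts_must T \<Longrightarrow> (a, t) \<in> N \<Longrightarrow> t \<in> dmts_states T"
  using assms unfolding dmts_component_def by blast+

text \<open>The DMTS disjunction is a plain union of relations, whereas the conditional in
  \<open>naa_disj\<close> prefers its first argument. Symmetry thus reduces the claim for the second
  disjunct to the one for the first.\<close>

lemma dmts_disj_commute: "S\<^sub>1 \<or>\<^sub>D S\<^sub>2 = S\<^sub>2 \<or>\<^sub>D S\<^sub>1"
  by (simp add: dmts_disj_def Un_commute)

text \<open>Well-formedness is used for both operands: transitions of \<open>S\<^sub>1\<close> end
  in \<open>S\<^sub>1\<close>, while those of \<open>S\<^sub>2\<close> start in
  \<open>S\<^sub>2\<close> and so, by disjointness, add nothing at states of
  \<open>S\<^sub>1\<close>.\<close>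

lemma dmts_component_disj_left:
  fixes S\<^sub>1 S\<^sub>2 :: "('s, 'a) dmts"
  assumes "is_dmts \<Sigma> S\<^sub>1" and "is_dmts \<Sigma> S\<^sub>2" and "dmts_states S\<^sub>1 \<inter> dmts_states S\<^sub>2 = {}"
  shows "dmts_component S\<^sub>1 (S\<^sub>1 \<or>\<^sub>D S\<^sub>2)"
proof -
  have may: "s \<in> dmts_states S \<and> t \<in> dmts_states S"
    if "is_dmts \<Sigma> S" and st: "(s, a, t) \<in> dmts_may S" for S :: "('s, 'a) dmts" and s a t
  proof -
    have "dmts_may S \<subseteq> dmts_states S \<times> \<Sigma> \<times> dmts_states S"
      using that(1) by (simp add: is_dmts_def)
    from subsetD[OF this st] show ?thesis by simp
  qed
  have must: "s \<in> dmts_states S \<and> (\<forall>a t. (a, t) \<in> N \<longrightarrow> t \<in> dmts_states S)"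
    if "is_dmts \<Sigma> S" and sN: "(s, N) \<in> dmts_must S" for S :: "('s, 'a) dmts" and s N
  proof -
    have "dmts_must S \<subseteq> dmts_states S \<times> Pow (\<Sigma> \<times> dmts_states S)"
      using that(1) by (simp add: is_dmts_def)
    from subsetD[OF this sN] show ?thesis by blast
  qed
  show ?thesis
    using may[OF assms(1)] may[OF assms(2)] must[OF assms(1)] must[OF assms(2)] assms(3)
    by (auto simp: dmts_component_def dmts_disj_def)
qed

lemma dmts_component_disj:
  assumes "is_dmts \<Sigma> S\<^sub>1" and "is_dmts \<Sigma> S\<^sub>2" and "dmts_states S\<^sub>1 \<inter> dmts_states S\<^sub>2 = {}"
  shows "dmts_component S\<^sub>1 (S\<^sub>1 \<or>\<^sub>D S\<^sub>2)" and "dmts_component S\<^sub>2 (S\<^sub>1 \<or>\<^sub>D S\<^sub>2)"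
  using dmts_component_disj_left[OF assms] dmts_component_disj_left[OF assms(2,1)] assms(3)
  by (simp_all add: dmts_disj_commute[of S\<^sub>1] Int_commute)

section \<open>Union, extension and restriction of DMTS refinements\<close>

text \<open>Both clauses of a refinement only ask for the existence of related targets, so witnesses
  found for one relation remain valid for the union.\<close>

lemma dmts_refinement_Un:
  assumes "dmts_refinement S T R" and "dmts_refinement S T R'"
  shows "dmts_refinement S T (R \<union> R')"
proof (rule dmts_refinementI)
  fix s t
  assume "(s, t) \<in> R \<union> R'"
  then consider "(s, t) \<in> R" | "(s, t) \<in> R'" by blast
  note * = this
  show "s \<in> dmts_states S \<and> t \<in> dmts_states T"
    using * assms[THEN dmts_refinementD(1)] assms[THEN dmts_refinementD(2)] by cases blast+
  show "\<exists>t'. (t, a, t') \<in> dmts_may T \<and> (s', t') \<in> R \<union> R'"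
    if "(s, a, s') \<in> dmts_may S" for a s'
    using * assms[THEN dmts_refinementD(3), OF _ that] by cases blast+
  show "\<exists>M. (s, M) \<in> dmts_must S \<and>
      (\<forall>a s'. (a, s') \<in> M \<longrightarrow> (\<exists>t'. (a, t') \<in> N \<and> (s', t') \<in> R \<union> R'))"
    if "(t, N) \<in> dmts_must T" for N
    using *
  proof cases
    case 1
    from dmts_refinementD(4)[OF assms(1) this that] show ?thesis by blast
  next
    case 2
    from dmts_refinementD(4)[OF assms(2) this that] show ?thesis by blast
  qed
qed

lemma dmts_refinement_extend_left:
  assumes "dmts_component T S" and "dmts_refinement T U R"
  shows "dmts_refinement S U R"
proof (rule dmts_refinementI)
  fix s u
  assume "(s, u) \<in> R"
  note D = dmts_refinementD[OF assms(2) this] and C = dmts_componentD[OF assms(1) D(1)]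
  show "s \<in> dmts_states S \<and> u \<in> dmts_states U"
    using C D by blast
  show "\<exists>t'. (u, a, t') \<in> dmts_may U \<and> (s', t') \<in> R"
    if "(s, a, s') \<in> dmts_may S" for a s'
    using that D(3)[of a s'] C(2,3) by blast
  show "\<exists>M. (s, M) \<in> dmts_must S \<and>
      (\<forall>a s'. (a, s') \<in> M \<longrightarrow> (\<exists>t'. (a, t') \<in> N \<and> (s', t') \<in> R))"
    if "(u, N) \<in> dmts_must U" for N
    using that D(4)[of N] C(4,5) by fastforce
qed

text \<open>Must transitions are answered from right to left, so enlarging the right side could
  create new obligations; at states of the component \<open>T\<close> it creates none.\<close>

lemma dmts_refinement_extend_right:
  assumes "dmts_component T S" and "dmts_refinement U T R"
  shows "dmts_refinement U S R"
proof (rule dmts_refinementI)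
  fix u s
  assume "(u, s) \<in> R"
  note D = dmts_refinementD[OF assms(2) this] and C = dmts_componentD[OF assms(1) D(2)]
  show "u \<in> dmts_states U \<and> s \<in> dmts_states S"
    using C D by blast
  show "\<exists>t'. (s, a, t') \<in> dmts_may S \<and> (s', t') \<in> R"
    if "(u, a, s') \<in> dmts_may U" for a s'
    using that D(3)[of a s'] C(2,3) by blast
  show "\<exists>M. (u, M) \<in> dmts_must U \<and>
      (\<forall>a s'. (a, s') \<in> M \<longrightarrow> (\<exists>t'. (a, t') \<in> N \<and> (s', t') \<in> R))"
    if "(s, N) \<in> dmts_must S" for N
    using that D(4)[of N] C(4,5) by fastforce
qed

lemma dmts_refinement_restrict_left:
  assumes "dmts_component T S" and "dmts_refinement S U R"
  shows "dmts_refinement T U (R \<inter> dmts_states T \<times> UNIV)"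
    (is "dmts_refinement _ _ ?R")
proof (rule dmts_refinementI)
  fix s u
  assume "(s, u) \<in> ?R"
  then have rel: "(s, u) \<in> R" and mem: "s \<in> dmts_states T"
    by auto
  note D = dmts_refinementD[OF assms(2) rel] and C = dmts_componentD[OF assms(1) mem]
  show "s \<in> dmts_states T \<and> u \<in> dmts_states U"
    using C D mem by blast
  show "\<exists>t'. (u, a, t') \<in> dmts_may U \<and> (s', t') \<in> ?R"
    if "(s, a, s') \<in> dmts_may T" for a s'
    using that D(3)[of a s'] C(2,3) by blast
  show "\<exists>M. (s, M) \<in> dmts_must T \<and>
      (\<forall>a s'. (a, s') \<in> M \<longrightarrow> (\<exists>t'. (a, t') \<in> N \<and> (s', t') \<in> ?R))"
    if "(u, N) \<in> dmts_must U" for N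
    \<comment> \<open>The answer \<open>M\<close> is a must transition of \<open>S\<close>;
      \<open>C(4)\<close> makes it one of \<open>T\<close>, and \<open>C(5)\<close> keeps its
      targets in \<open>T\<close>, so the related pairs lie in the restriction.\<close>
    using that D(4)[of N] C(4,5) by fastforce
qed

text \<open>For may, the answering target is reached from a state of \<open>T\<close> and so stays
  in \<open>T\<close>; for must, the answering targets are taken from \<open>N\<close>, which is
  itself a must set of \<open>T\<close>.\<close>

lemma dmts_refinement_restrict_right:
  assumes "dmts_component T S" and "dmts_refinement U S R"
  shows "dmts_refinement U T (R \<inter> UNIV \<times> dmts_states T)"
    (is "dmts_refinement _ _ ?R")
proof (rule dmts_refinementI)
  fix u s
  assume "(u, s) \<in> ?R"
  then have rel: "(u, s) \<in> R" and mem: "s \<in> dmts_states T"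
    by auto
  note D = dmts_refinementD[OF assms(2) rel] and C = dmts_componentD[OF assms(1) mem]
  show "u \<in> dmts_states U \<and> s \<in> dmts_states T"
    using C D mem by blast
  show "\<exists>t'. (s, a, t') \<in> dmts_may T \<and> (s', t') \<in> ?R"
    if "(u, a, s') \<in> dmts_may U" for a s'
    using that D(3)[of a s'] C(2,3) by blast
  show "\<exists>M. (u, M) \<in> dmts_must U \<and>
      (\<forall>a s'. (a, s') \<in> M \<longrightarrow> (\<exists>t'. (a, t') \<in> N \<and> (s', t') \<in> ?R))"
    if "(s, N) \<in> dmts_must T" for N
    using that D(4)[of N] C(4,5) by fastforce
qed

section \<open>Disjunction of DMTS as least upper bound and as union of implementations\<close>

lemma dmts_disj_refines_iff:
  assumes "is_dmts \<Sigma> S\<^sub>1" and "is_dmts \<Sigma> S\<^sub>2" and "dmts_states S\<^sub>1 \<inter> dmts_states S\<^sub>2 = {}"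
  shows "S\<^sub>1 \<or>\<^sub>D S\<^sub>2 \<le>\<^sub>D S\<^sub>3 \<longleftrightarrow> S\<^sub>1 \<le>\<^sub>D S\<^sub>3 \<and> S\<^sub>2 \<le>\<^sub>D S\<^sub>3"
proof
  note comp = dmts_component_disj[OF assms]
  have init: "dmts_init S\<^sub>1 \<subseteq> dmts_states S\<^sub>1" "dmts_init S\<^sub>2 \<subseteq> dmts_states S\<^sub>2"
    using assms(1,2) by (simp_all add: is_dmts_def)
  show "S\<^sub>1 \<le>\<^sub>D S\<^sub>3 \<and> S\<^sub>2 \<le>\<^sub>D S\<^sub>3" if le: "S\<^sub>1 \<or>\<^sub>D S\<^sub>2 \<le>\<^sub>D S\<^sub>3"
  proof -
    obtain R where ref: "dmts_refinement (S\<^sub>1 \<or>\<^sub>D S\<^sub>2) S\<^sub>3 R"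
      and ini: "initialised (dmts_init (S\<^sub>1 \<or>\<^sub>D S\<^sub>2)) (dmts_init S\<^sub>3) R"
      using le unfolding dmts_refines_def by blast
    have "initialised (dmts_init S\<^sub>1) (dmts_init S\<^sub>3) (R \<inter> dmts_states S\<^sub>1 \<times> UNIV)"
      "initialised (dmts_init S\<^sub>2) (dmts_init S\<^sub>3) (R \<inter> dmts_states S\<^sub>2 \<times> UNIV)"
      using ini init by (auto simp: initialised_def dmts_disj_def)
    then show ?thesis
      using comp[THEN dmts_refinement_restrict_left, OF ref] unfolding dmts_refines_def by blast
  qed
  show "S\<^sub>1 \<or>\<^sub>D S\<^sub>2 \<le>\<^sub>D S\<^sub>3" if le: "S\<^sub>1 \<le>\<^sub>D S\<^sub>3 \<and> S\<^sub>2 \<le>\<^sub>D S\<^sub>3"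
  proof -
    obtain R\<^sub>1 R\<^sub>2 where ref: "dmts_refinement S\<^sub>1 S\<^sub>3 R\<^sub>1" "dmts_refinement S\<^sub>2 S\<^sub>3 R\<^sub>2"
      and ini: "initialised (dmts_init S\<^sub>1) (dmts_init S\<^sub>3) R\<^sub>1"
        "initialised (dmts_init S\<^sub>2) (dmts_init S\<^sub>3) R\<^sub>2"
      using le unfolding dmts_refines_def by blast
    have "dmts_refinement (S\<^sub>1 \<or>\<^sub>D S\<^sub>2) S\<^sub>3 (R\<^sub>1 \<union> R\<^sub>2)"
      using comp ref by (intro dmts_refinement_Un) (blast intro: dmts_refinement_extend_left)+
    moreover have "initialised (dmts_init (S\<^sub>1 \<or>\<^sub>D S\<^sub>2)) (dmts_init S\<^sub>3) (R\<^sub>1 \<union> R\<^sub>2)"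
      using ini by (fastforce simp: initialised_def dmts_disj_def)
    ultimately show ?thesis
      unfolding dmts_refines_def by blast
  qed
qed

lemma refines_dmts_disj_iff:
  assumes "is_dmts \<Sigma> S\<^sub>1" and "is_dmts \<Sigma> S\<^sub>2" and "dmts_states S\<^sub>1 \<inter> dmts_states S\<^sub>2 = {}"
    and "dmts_init I = {i}"
  shows "I \<le>\<^sub>D S\<^sub>1 \<or>\<^sub>D S\<^sub>2 \<longleftrightarrow> I \<le>\<^sub>D S\<^sub>1 \<or> I \<le>\<^sub>D S\<^sub>2"
proof
  note comp = dmts_component_disj[OF assms(1-3)]
  have init: "dmts_init S\<^sub>1 \<subseteq> dmts_states S\<^sub>1" "dmts_init S\<^sub>2 \<subseteq> dmts_states S\<^sub>2"
    using assms(1,2) by (simp_all add: is_dmts_def)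
  show "I \<le>\<^sub>D S\<^sub>1 \<or> I \<le>\<^sub>D S\<^sub>2" if le: "I \<le>\<^sub>D S\<^sub>1 \<or>\<^sub>D S\<^sub>2"
  proof -
    obtain R where ref: "dmts_refinement I (S\<^sub>1 \<or>\<^sub>D S\<^sub>2) R"
      and ini: "initialised (dmts_init I) (dmts_init (S\<^sub>1 \<or>\<^sub>D S\<^sub>2)) R"
      using le unfolding dmts_refines_def by blast
    \<comment> \<open>As for NAA, the single initial state \<open>i\<close> has a partner that is
      initial in one disjunct, and that disjunct alone receives the refinement.\<close>
    have "initialised (dmts_init I) (dmts_init S\<^sub>1) (R \<inter> UNIV \<times> dmts_states S\<^sub>1) \<or>
      initialised (dmts_init I) (dmts_init S\<^sub>2) (R \<inter> UNIV \<times> dmts_states S\<^sub>2)"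
      using ini init assms(4) by (auto simp: initialised_def dmts_disj_def)
    then show ?thesis
      using comp[THEN dmts_refinement_restrict_right, OF ref] unfolding dmts_refines_def by blast
  qed
  show "I \<le>\<^sub>D S\<^sub>1 \<or>\<^sub>D S\<^sub>2" if le: "I \<le>\<^sub>D S\<^sub>1 \<or> I \<le>\<^sub>D S\<^sub>2"
  proof -
    obtain R where "dmts_refinement I (S\<^sub>1 \<or>\<^sub>D S\<^sub>2) R"
      \<comment> \<open>One relation serves in either case: a refinement into a disjunct is already
        one into the disjunction, so only initialisation remembers the disjunct.\<close>
      and "initialised (dmts_init I) (dmts_init S\<^sub>1) R \<or> initialised (dmts_init I) (dmts_init S\<^sub>2) R"
      using le comp[THEN dmts_refinement_extend_right] unfolding dmts_refines_def by blast
    moreover from this(2) have "initialised (dmts_init I) (dmts_init (S\<^sub>1 \<or>\<^sub>D S\<^sub>2)) R"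
      by (auto simp: initialised_def dmts_disj_def)
    ultimately show ?thesis
      unfolding dmts_refines_def by blast
  qed
qed

lemma dmts_impl_disj:
  assumes "is_dmts \<Sigma> S\<^sub>1" and "is_dmts \<Sigma> S\<^sub>2" and "dmts_states S\<^sub>1 \<inter> dmts_states S\<^sub>2 = {}"
  shows "dmts_impl \<Sigma> (S\<^sub>1 \<or>\<^sub>D S\<^sub>2) = dmts_impl \<Sigma> S\<^sub>1 \<union> dmts_impl \<Sigma> S\<^sub>2"
proof -
  have "dmts_init (dmts_of_lts I) = {lts_init I}" for I :: "('i, 'a) lts"
    by (simp add: dmts_of_lts_def)
  from refines_dmts_disj_iff[OF assms this] show ?thesis
    by (auto simp: dmts_impl_def)
qed

theorem theorem2:
  fixes \<Sigma> :: "'a set"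
  assumes "finite \<Sigma>"
  shows "(\<forall>(S\<^sub>1 :: ('s, 'a) naa) (S\<^sub>2 :: ('s, 'a) naa) (S\<^sub>3 :: ('t, 'a) naa).
            is_naa \<Sigma> S\<^sub>1 \<longrightarrow> is_naa \<Sigma> S\<^sub>2 \<longrightarrow> is_naa \<Sigma> S\<^sub>3 \<longrightarrow>
            naa_states S\<^sub>1 \<inter> naa_states S\<^sub>2 = {} \<longrightarrow>
              (naa_impl \<Sigma> (S\<^sub>1 \<or>\<^sub>N S\<^sub>2) :: ('i, 'a) lts set) = naa_impl \<Sigma> S\<^sub>1 \<union> naa_impl \<Sigma> S\<^sub>2 \<and>
              (S\<^sub>1 \<or>\<^sub>N S\<^sub>2 \<le>\<^sub>N S\<^sub>3 \<longleftrightarrow> S\<^sub>1 \<le>\<^sub>N S\<^sub>3 \<and> S\<^sub>2 \<le>\<^sub>N S\<^sub>3)) \<and>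
         (\<forall>(S\<^sub>1 :: ('u, 'a) dmts) (S\<^sub>2 :: ('u, 'a) dmts) (S\<^sub>3 :: ('v, 'a) dmts).
            is_dmts \<Sigma> S\<^sub>1 \<longrightarrow> is_dmts \<Sigma> S\<^sub>2 \<longrightarrow> is_dmts \<Sigma> S\<^sub>3 \<longrightarrow>
            dmts_states S\<^sub>1 \<inter> dmts_states S\<^sub>2 = {} \<longrightarrow>
              (dmts_impl \<Sigma> (S\<^sub>1 \<or>\<^sub>D S\<^sub>2) :: ('j, 'a) lts set) = dmts_impl \<Sigma> S\<^sub>1 \<union> dmts_impl \<Sigma> S\<^sub>2 \<and>
              (S\<^sub>1 \<or>\<^sub>D S\<^sub>2 \<le>\<^sub>D S\<^sub>3 \<longleftrightarrow> S\<^sub>1 \<le>\<^sub>D S\<^sub>3 \<and> S\<^sub>2 \<le>\<^sub>D S\<^sub>3))"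
  by (intro conjI allI impI)
    (rule naa_impl_disj naa_disj_refines_iff dmts_impl_disj dmts_disj_refines_iff; assumption)+

end
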